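(* For every Nim game $G$ (a sum of any finite number of nimbers) and every integer $n \geq 2b(G)+1$, $$(G+n* )\circ G = 0 \quad\text{or}\quad (G+(n+1)* )\circ G = 0 .$$
   Context: All games are short impartial games under normal play (a player unable to move loses): a position is identified with its finite set of options; there are no infinite plays. The empty game (no options) is denoted $0$. $G\equiv H$ means that $G$ and $H$ have the same option sets (are identical as games). $G+H$ is the disjunctive sum. $G=0$ means that $G$ is a $\mathcal P$-position, i.e. the previous player (the player not about to move) has a winning strategy. The nimber $*n$ is the game with options $*k$, $0\le k<n$; $*$ denotes $*1$. A Nim game is a disjunctive sum of a finite number of nimbers. $n*$ denotes the disjunctive sum $*+*+\cdots+*$ of $n$ copies of $*=*1$. The birthday $b(G)$ is the maximal number of moves that can be played in $G$ (for a Nim game, the total number of tokens). The split sum $G\circ H$ is defined recursively by: $G\circ H\equiv 0$ if $G\equiv 0$; $G\circ H\equiv G$ if $H\equiv 0$; and otherwise $G\circ H\equiv\{G\circ h,\ g\circ H\}$, where $g$ ranges over the options of $G$ and $h$ over the options of $H$. *)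

theory Defs
  imports Main "HOL-Library.FSet"
begin

text \<open>
  A short impartial game is its finite set of options, so HOL equality on this datatype is
  identity of games (\<open>\<equiv>\<close> in the literature), not equality of outcomes or values.
\<close>

datatype game = Game (options: "game fset")

definition move :: "game \<Rightarrow> game \<Rightarrow> bool" where
  "move G H \<longleftrightarrow> H |\<in>| options G"

lemma size_option [termination_simp]: "g |\<in>| options G \<Longrightarrow> size g < size G"
proof (cases G)
  case (Game A)
  assume "g |\<in>| options G"
  with Game have "Suc (size g) \<le> (\<Sum>x\<in>fset A. Suc (size x))"
    by (intro member_le_sum) auto
  with Game show ?thesis by simp
qed

lemma game_induct [case_names game]:
  assumes "\<And>G. (\<And>g. g |\<in>| options G \<Longrightarrow> P g) \<Longrightarrow> P G"
  shows "P G"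
  by (induction G rule: measure_induct_rule[of size]) (auto intro: assms size_option)

lemma fimage_cong_fundef [fundef_cong]:
  "M = N \<Longrightarrow> (\<And>x. x |\<in>| N \<Longrightarrow> f x = g x) \<Longrightarrow> f |`| M = g |`| N"
  by (rule fset.map_cong)


subsection \<open>Disjunctive sum\<close>

fun game_add :: "game \<Rightarrow> game \<Rightarrow> game" where
  "game_add G H =
     Game ((\<lambda>g. game_add g H) |`| options G |\<union>| (\<lambda>h. game_add G h) |`| options H)"

declare game_add.simps [simp del]

instantiation game :: comm_monoid_add
begin

definition zero_game :: game where
  "0 = Game {||}"

definition plus_game :: "game \<Rightarrow> game \<Rightarrow> game" where
  "G + H = game_add G H"

lemma options_plus':
  "options (G + H :: game) = (\<lambda>g. g + H) |`| options G |\<union>| (\<lambda>h. G + h) |`| options H"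
  unfolding plus_game_def by (subst game_add.simps) simp

instance
proof
  fix a b c :: game
  show "a + b + c = a + (b + c)"
  proof (induction "size a + size b + size c" arbitrary: a b c rule: less_induct)
    case less
    have "(\<lambda>x. x + b + c) |`| options a = (\<lambda>x. x + (b + c)) |`| options a"
      "(\<lambda>x. a + x + c) |`| options b = (\<lambda>x. a + (x + c)) |`| options b"
      "(\<lambda>x. a + b + x) |`| options c = (\<lambda>x. a + (b + x)) |`| options c"
      by (auto intro!: fset.map_cong less simp: size_option)
    then have "options (a + b + c) = options (a + (b + c))"
      by (simp add: options_plus' fimage_funion fset.map_comp comp_def funion_assoc)
    then show ?case by (simp add: game.expand)
  qed
  show "a + b = b + a"
  proof (induction "size a + size b" arbitrary: a b rule: less_induct)
    case less
    have "(\<lambda>x. x + b) |`| options a = (\<lambda>x. b + x) |`| options a"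
      "(\<lambda>x. a + x) |`| options b = (\<lambda>x. x + a) |`| options b"
      by (auto intro!: fset.map_cong less simp: size_option)
    then have "options (a + b) = options (b + a)"
      by (simp add: options_plus' funion_commute)
    then show ?case by (simp add: game.expand)
  qed
  show "0 + a = a"
  proof (induction a rule: game_induct)
    case (game a)
    have "(\<lambda>x. 0 + x) |`| options a = (\<lambda>x. x) |`| options a"
      using game by (intro fset.map_cong) auto
    then have "options (0 + a) = options a"
      by (simp add: options_plus' zero_game_def[symmetric]) (simp add: zero_game_def)
    then show ?case by (simp add: game.expand)
  qed
qed

end


subsection \<open>Nim games\<close>

lemma fset_of_list_upt [termination_simp]: "k |\<in>| fset_of_list [m..<n] \<longleftrightarrow> m \<le> k \<and> k < n"
  by (auto simp: fset_of_list.rep_eq)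

fun nimber :: "nat \<Rightarrow> game" where
  "nimber n = Game (nimber |`| fset_of_list [0..<n])"

declare nimber.simps [simp del]

lemma options_nimber: "fset (options (nimber n)) = nimber ` {..<n}"
  by (subst nimber.simps) (auto simp: fset_of_list.rep_eq)

definition stars :: "nat \<Rightarrow> game" where
  "stars n = sum_list (replicate n (nimber 1))"

definition nim_game :: "game \<Rightarrow> bool" where
  "nim_game G \<longleftrightarrow> (\<exists>ns. G = sum_list (map nimber ns))"


subsection \<open>Birthday\<close>

definition birthday :: "game \<Rightarrow> nat" where
  "birthday G = Max {n. \<exists>H. (move ^^ n) G H}"

lemma play_bounded: "(move ^^ n) G H \<Longrightarrow> n + size H \<le> size G"
proof (induction n arbitrary: H)
  case (Suc n)
  then obtain K where "(move ^^ n) G K" "move K H" by auto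
  have "size H < size K" using \<open>move K H\<close> by (simp add: move_def size_option)
  with Suc.IH[OF \<open>(move ^^ n) G K\<close>] show ?case by linarith
qed simp

lemma finite_plays: "finite {n. \<exists>H. (move ^^ n) G H}"
  by (rule finite_subset[of _ "{..size G}"]) (auto dest: play_bounded)

lemma plays_nonempty: "{n. \<exists>H. (move ^^ n) G H} \<noteq> {}"
proof -
  have "(move ^^ 0) G G" by simp
  then show ?thesis by blast
qed

lemma birthday_rec: "birthday G = Max (insert 0 ((\<lambda>g. Suc (birthday g)) ` fset (options G)))"
proof (rule antisym)
  show "birthday G \<le> Max (insert 0 ((\<lambda>g. Suc (birthday g)) ` fset (options G)))"
    unfolding birthday_def[of G]
  proof (rule Max.boundedI[OF finite_plays])
    show "{n. \<exists>H. (move ^^ n) G H} \<noteq> {}" by (rule plays_nonempty)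
  next
    fix n assume "n \<in> {n. \<exists>H. (move ^^ n) G H}"
    then obtain H where H: "(move ^^ n) G H" by blast
    show "n \<le> Max (insert 0 ((\<lambda>g. Suc (birthday g)) ` fset (options G)))"
    proof (cases n)
      case (Suc m)
      with H obtain g where g: "move G g" "(move ^^ m) g H"
        by (metis relpowp_Suc_D2)
      have "m \<le> birthday g"
        unfolding birthday_def using g by (intro Max_ge[OF finite_plays]) auto
      with g Suc show ?thesis
        by (intro Max_ge_iff[THEN iffD2]) (auto simp: move_def)
    qed simp
  qed
next
  have "Suc (birthday g) \<le> birthday G" if "g |\<in>| options G" for g
  proof -
    have "birthday g \<in> {n. \<exists>H. (move ^^ n) g H}"
      unfolding birthday_def by (rule Max_in[OF finite_plays plays_nonempty])
    then obtain H where "(move ^^ birthday g) g H" by blast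
    with that have "(move ^^ Suc (birthday g)) G H"
      by (metis move_def relpowp_Suc_I2)
    then show ?thesis
      unfolding birthday_def[of G] by (intro Max_ge[OF finite_plays]) blast
  qed
  then show "Max (insert 0 ((\<lambda>g. Suc (birthday g)) ` fset (options G))) \<le> birthday G"
    by (auto intro!: Max.boundedI)
qed


subsection \<open>P-positions\<close>

text \<open>
  The positions with the opponent to move that can arise from \<open>G\<close> when the previous player
  answers every position \<open>h\<close> reached by the opponent with \<open>s h\<close>.
\<close>

inductive_set reachable :: "(game \<Rightarrow> game) \<Rightarrow> game \<Rightarrow> game set" for s G where
  start: "G \<in> reachable s G"
| reply: "H \<in> reachable s G \<Longrightarrow> move H h \<Longrightarrow> s h \<in> reachable s G"

text \<open>
  A strategy wins under normal play iff it always supplies a legal reply: plays are finite, so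
  the opponent is then the player who gets stuck.
\<close>

definition winning_strategy :: "(game \<Rightarrow> game) \<Rightarrow> game \<Rightarrow> bool" where
  "winning_strategy s G \<longleftrightarrow> (\<forall>H\<in>reachable s G. \<forall>h. move H h \<longrightarrow> move h (s h))"

definition P_position :: "game \<Rightarrow> bool" where
  "P_position G \<longleftrightarrow> (\<exists>s. winning_strategy s G)"

lemma winning_strategy_reply:
  assumes "winning_strategy s G" "move G g"
  shows "winning_strategy s (s g)"
proof -
  have "H \<in> reachable s G" if "H \<in> reachable s (s g)" for H
    using that by induction (auto intro: reachable.intros assms(2))
  with assms(1) show ?thesis by (auto simp: winning_strategy_def)
qed

lemma P_position_rec: "P_position G \<longleftrightarrow> (\<forall>g. move G g \<longrightarrow> \<not> P_position g)"
proof -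
  have 1: "\<exists>h. move g h \<and> P_position h" if "P_position G" "move G g" for G g
    using that winning_strategy_reply
    by (metis P_position_def reachable.start winning_strategy_def)
  have 2: "P_position G" if ex: "\<forall>g. move G g \<longrightarrow> (\<exists>h. move g h \<and> P_position h)" for G
  proof -
    define s where "s g = (SOME h. move g h \<and> P_position h)" for g
    have s: "move g (s g) \<and> P_position (s g)" if "\<exists>h. move g h \<and> P_position h" for g
      unfolding s_def using that by (rule someI_ex)
    have inv: "H = G \<or> P_position H" if "H \<in> reachable s G" for H
      using that by induction (use s ex 1 in metis)+
    have "winning_strategy s G"
      unfolding winning_strategy_def using inv s ex 1 by metis
    then show ?thesis by (auto simp: P_position_def)
  qed
  show ?thesis
  proof (induction G rule: game_induct)
    case (game G)
    then have IH: "P_position g \<longleftrightarrow> (\<forall>h. move g h \<longrightarrow> \<not> P_position h)" if "move G g" for g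
      using that by (simp add: move_def)
    show ?case using 1[of G] 2[of G] IH by metis
  qed
qed


subsection \<open>Split sum\<close>

fun split_sum :: "game \<Rightarrow> game \<Rightarrow> game" (infixl "\<circ>\<^sub>s" 70) where
  "G \<circ>\<^sub>s H =
     (if G = 0 then 0 else if H = 0 then G
      else Game ((\<lambda>h. G \<circ>\<^sub>s h) |`| options H |\<union>| (\<lambda>g. g \<circ>\<^sub>s H) |`| options G))"

declare split_sum.simps [simp del]

end

theory Submission
  imports Defs "HOL-Library.Multiset"
begin

text \<open>
  Let \<open>X \<noteq> 0\<close>. While \<open>B \<noteq> 0\<close>, the options of \<open>X \<circ>\<^sub>s B\<close> come from a move in either component; when
  \<open>B = 0\<close>, only those from \<open>X\<close> exist, which is the same recursion. A move in \<open>B\<close> that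
  raises the Grundy value can be reversed by a further move in \<open>B\<close>, so the outcome of
  \<open>X \<circ>\<^sub>s B\<close> depends on \<open>B\<close> only through its Grundy value
  (\<open>P_position_split_sum_grundy\<close>). Hence \<open>B\<close> may be replaced by a nimber \<open>*v\<close>, and
  since the nimbers are options of one another, at most one \<open>v\<close> makes \<open>X \<circ>\<^sub>s *v\<close> a
  P-position. This \<open>v\<close>, if it exists, is a substitute for the Grundy value of \<open>X\<close>, distorted by
  the rule that the play also stops when \<open>X\<close> is exhausted.

  The distortion is mild for a Nim position with many heaps of size one: there \<open>v\<close> exists and
  agrees with the nim sum \<open>s\<close> up to the last binary digit (\<open>many_ones_balanced\<close>). Indeed, every
  value below \<open>2 * (s div 2)\<close> is taken by an option: among the moves of ordinary Nim there are
  two that leave the same heap with \<open>2 * i\<close> and with \<open>2 * i + 1\<close> tokens and both reach the right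
  nim sum up to the last digit. One of these two positions is an option of the other, so their
  values are different and fill the whole pair. On the other hand the two values in the pair of
  \<open>s\<close> itself cannot both be taken: the options taking them arise by removing one token from two
  different odd heaps, and the position where both tokens are removed also has a value in that
  pair, although it is an option of both.

  Finally let \<open>X = G + n*\<close>. Adding one star changes only the last digit of the nim sum, and
  \<open>X\<close> is an option of \<open>X + *\<close>. So the values of these two games are different members of the pair
  that contains the Grundy value of \<open>G\<close>, and one of them is that Grundy value. The last digit
  itself is not determined by nim sums, which is why two consecutive numbers of stars appear.
\<close>

section \<open>Outcomes of split sums\<close>

lemma split_sum_0_left [simp]: "0 \<circ>\<^sub>s H = 0"
  by (simp add: split_sum.simps)

lemma split_sum_0_right [simp]: "G \<circ>\<^sub>s 0 = G"
  by (simp add: split_sum.simps)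

lemma options_0 [simp]: "options 0 = {||}"
  by (simp add: zero_game_def)

lemma P_position_0: "P_position 0"
  by (subst P_position_rec) (simp add: move_def)

text \<open>
  The case \<open>B = 0\<close> fits the general recursion because \<open>X \<circ>\<^sub>s 0 = X\<close> and \<open>x \<circ>\<^sub>s 0 = x\<close>; only \<open>X = 0\<close>,
  where the play is over although \<open>B\<close> may have options, does not.
\<close>

lemma P_position_split_sum:
  assumes "X \<noteq> 0"
  shows "P_position (X \<circ>\<^sub>s B) \<longleftrightarrow>
    (\<forall>x. move X x \<longrightarrow> \<not> P_position (x \<circ>\<^sub>s B)) \<and> (\<forall>b. move B b \<longrightarrow> \<not> P_position (X \<circ>\<^sub>s b))"
proof (cases "B = 0")
  case True
  then show ?thesis
    using P_position_rec[of X] by (simp add: move_def)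
next
  case False
  then have "options (X \<circ>\<^sub>s B) = (\<lambda>b. X \<circ>\<^sub>s b) |`| options B |\<union>| (\<lambda>x. x \<circ>\<^sub>s B) |`| options X"
    using assms by (subst split_sum.simps) simp
  then show ?thesis
    by (subst P_position_rec) (auto simp: move_def)
qed

lemma move_nimber: "move (nimber n) g \<longleftrightarrow> (\<exists>k<n. g = nimber k)"
  using options_nimber[of n] by (auto simp: move_def)

lemma P_position_split_nimber_unique:
  assumes "X \<noteq> 0" "P_position (X \<circ>\<^sub>s nimber v)" "P_position (X \<circ>\<^sub>s nimber w)"
  shows "v = w"
  using assms P_position_split_sum[OF assms(1)] move_nimber by (metis nat_neq_iff)

section \<open>Grundy values\<close>

function grundy :: "game \<Rightarrow> nat" where
  "grundy G = (LEAST v. v |\<notin>| grundy |`| options G)"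
  by auto
termination by (relation "Wellfounded.measure size") (auto simp: size_option)

declare grundy.simps [simp del]

lemma grundy_notin: "grundy G |\<notin>| grundy |`| options G"
proof -
  have "\<exists>v. v |\<notin>| grundy |`| options G"
    using ex_new_if_finite[OF infinite_UNIV_nat, of "fset (grundy |`| options G)"] by auto
  then show ?thesis
    by (subst (1) grundy.simps) (rule LeastI_ex)
qed

lemma grundy_move_neq: "move G g \<Longrightarrow> grundy g \<noteq> grundy G"
  using grundy_notin[of G] unfolding move_def by (metis fimage_eqI)

lemma grundy_less: "w < grundy G \<Longrightarrow> \<exists>g. move G g \<and> grundy g = w"
proof -
  assume "w < grundy G"
  then have "w < (LEAST v. v |\<notin>| grundy |`| options G)"
    by (subst (asm) grundy.simps)
  from not_less_Least[OF this] show ?thesis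
    by (auto simp: move_def)
qed

lemma grundy_eqI:
  assumes "\<And>g. move G g \<Longrightarrow> grundy g \<noteq> v"
    and "\<And>w. w < v \<Longrightarrow> \<exists>g. move G g \<and> grundy g = w"
  shows "grundy G = v"
  using assms grundy_less grundy_move_neq by (metis nat_neq_iff)

lemma grundy_nimber: "grundy (nimber n) = n"
proof (induction n rule: less_induct)
  case (less n)
  show ?case
  proof (rule grundy_eqI)
    fix g assume "move (nimber n) g"
    then obtain k where "k < n" "g = nimber k" by (auto simp: move_nimber)
    then show "grundy g \<noteq> n" using less.IH by simp
  next
    fix w assume "w < n"
    then show "\<exists>g. move (nimber n) g \<and> grundy g = w"
      using less.IH by (auto simp: move_nimber)
  qed
qed

text \<open>
  A winner of \<open>X \<circ>\<^sub>s B\<close> also wins \<open>X \<circ>\<^sub>s C\<close>: moves in \<open>X\<close> and moves of \<open>C\<close> to smaller Grundy values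
  have counterparts in \<open>X \<circ>\<^sub>s B\<close>, and moves of \<open>C\<close> to larger Grundy values are reversed.
\<close>

lemma P_position_split_sum_grundy_imp:
  assumes "grundy B = grundy C" "P_position (X \<circ>\<^sub>s B)"
  shows "P_position (X \<circ>\<^sub>s C)"
  using assms
proof (induction "size X + size B + size C" arbitrary: X B C rule: less_induct)
  case less
  have size: "size g < size G" if "move G g" for g G
    using that by (simp add: move_def size_option)
  show ?case
  proof (cases "X = 0")
    case True
    then show ?thesis by (simp add: P_position_0)
  next
    case False
    note B = P_position_split_sum[OF False, of B, THEN iffD1, OF less.prems(2)]
    have 1: "\<not> P_position (x \<circ>\<^sub>s C)" if "move X x" for x
      using less.hyps[of x C B] size[OF that] less.prems(1) B that by auto
    have 2: "\<not> P_position (X \<circ>\<^sub>s c)" if c: "move C c" for c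
    proof (cases "grundy c < grundy C")
      case True
      then obtain b where b: "move B b" "grundy b = grundy c"
        using grundy_less less.prems(1) by metis
      then show ?thesis
        using less.hyps[of X c b] size[OF b(1)] size[OF c] B by auto
    next
      case False
      then have "grundy C < grundy c"
        using grundy_move_neq[OF c] by simp
      then obtain d where d: "move c d" "grundy d = grundy C"
        using grundy_less by metis
      have "P_position (X \<circ>\<^sub>s d)"
        using less.hyps[of X B d] size[OF d(1)] size[OF c] d less.prems by simp
      then show ?thesis
        using P_position_split_sum[OF \<open>X \<noteq> 0\<close>] d(1) by blast
    qed
    show ?thesis
      using P_position_split_sum[OF False] 1 2 by blast
  qed
qed

lemma P_position_split_sum_grundy:
  "P_position (X \<circ>\<^sub>s B) \<longleftrightarrow> P_position (X \<circ>\<^sub>s nimber (grundy B))"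
  using P_position_split_sum_grundy_imp grundy_nimber by metis

section \<open>Nim sums and Bouton's theorem\<close>

unbundle bit_operations_syntax

lemma xor_div_2: "(a XOR b) div 2 = (a div 2) XOR (b div 2 :: nat)"
  using drop_bit_xor[of 1 a b] by (simp add: drop_bit_eq_div)

text \<open>
  This is Bouton's theorem for two heaps. It holds by recursion on binary digits: all digits
  but the last decide unless \<open>j\<close> and \<open>a XOR b\<close> agree in them, and then a last digit is cleared.
\<close>

lemma less_xor_cases:
  fixes a b j :: nat
  assumes "j < a XOR b"
  shows "j XOR b < a \<or> j XOR a < b"
  using assms
proof (induction a arbitrary: b j rule: less_induct)
  case (less a)
  have cancel: "x XOR (x XOR y) = y" for x y :: nat
    by (metis xor.assoc xor_self_eq xor.left_neutral)
  have div_less: "x < y" if "x div 2 < y div 2" for x y :: nat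
    using that by linarith
  have odd_if: "even x \<and> odd y" if "x < y" "x div 2 = y div 2" for x y :: nat
    using that by presburger
  have less_if: "x < y" if "x div 2 = y div 2" "even x" "odd y" for x y :: nat
    using that by presburger
  have odd: "odd (x XOR y) \<longleftrightarrow> odd x \<noteq> odd y" for x y :: nat
    using even_xor_iff[of x y] by blast
  show ?case
  proof (cases "a = 0")
    case True
    then show ?thesis using less.prems by simp
  next
    case a: False
    show ?thesis
    proof (cases "j div 2 = (a XOR b) div 2")
      case True
      have bits: "even j" "odd (a XOR b)"
        using odd_if[OF less.prems True] by auto
      have halves: "(j XOR b) div 2 = a div 2" "(j XOR a) div 2 = b div 2"
        unfolding xor_div_2 True by (metis cancel xor.commute)+
      show ?thesis
      proof (cases "odd a")
        case True
        then have "even (j XOR b)" using bits odd[of a b] odd[of j b] by simp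
        with True show ?thesis using less_if[OF halves(1)] by simp
      next
        case False
        then have "even (j XOR a)" "odd b" using bits odd[of a b] odd[of j a] by simp_all
        then show ?thesis using less_if[OF halves(2)] by simp
      qed
    next
      case False
      then have "j div 2 < a div 2 XOR b div 2"
        using less.prems div_le_mono[of j "a XOR b" 2] by (simp add: xor_div_2)
      then have "(j XOR b) div 2 < a div 2 \<or> (j XOR a) div 2 < b div 2"
        using less.IH[of "a div 2" "j div 2" "b div 2"] a by (simp add: xor_div_2)
      then show ?thesis using div_less[of "j XOR b" a] div_less[of "j XOR a" b] by argo
    qed
  qed
qed

lemma same_half:
  fixes u v w :: nat
  assumes "v div 2 = j" "w div 2 = j" "u div 2 = j" "v \<noteq> w"
  shows "u = v \<or> u = w"
proof -
  have "x = 2 * j \<or> x = 2 * j + 1" if "x div 2 = j" for x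
    using that by linarith
  from this[OF assms(1)] this[OF assms(2)] this[OF assms(3)] assms(4) show ?thesis
    by auto
qed

definition nim_sum :: "nat multiset \<Rightarrow> nat" where
  "nim_sum M = fold_mset (XOR) 0 M"

lemma nim_sum_empty [simp]: "nim_sum {#} = 0"
  by (simp add: nim_sum_def)

lemma nim_sum_add_mset [simp]: "nim_sum (add_mset h M) = h XOR nim_sum M"
proof -
  interpret comp_fun_commute "(XOR) :: nat \<Rightarrow> nat \<Rightarrow> nat"
    by standard (auto simp: fun_eq_iff xor.left_commute)
  show ?thesis by (simp add: nim_sum_def)
qed

lemma nim_sum_div_2: "nim_sum M div 2 = nim_sum (image_mset (\<lambda>h. h div 2) M)"
  by (induction M) (simp_all add: xor_div_2)

lemma less_nim_sum:
  assumes "j < nim_sum M"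
  shows "\<exists>h R k. M = add_mset h R \<and> k < h \<and> k XOR nim_sum R = j"
  using assms
proof (induction M arbitrary: j)
  case empty
  then show ?case by simp
next
  case (add h M)
  have cancel: "(j XOR x) XOR x = j" for x
    by (simp add: xor.assoc)
  from less_xor_cases[of j h "nim_sum M"] add.prems
  consider "j XOR nim_sum M < h" | "j XOR h < nim_sum M" by auto
  then show ?case
  proof cases
    case 1
    then show ?thesis using cancel by blast
  next
    case 2
    from add.IH[OF this] obtain g R k where "M = add_mset g R" "k < g" "k XOR nim_sum R = j XOR h"
      by blast
    moreover from this have "k XOR nim_sum (add_mset h R) = j"
      using cancel[of h] by (metis nim_sum_add_mset xor.commute xor.left_commute)
    ultimately have "add_mset h M = add_mset g (add_mset h R) \<and> k < g \<and> k XOR nim_sum (add_mset h R) = j"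
      by simp
    then show ?thesis by blast
  qed
qed

lemma nimber_0 [simp]: "nimber 0 = 0"
  by (simp add: nimber.simps zero_game_def)

definition nim :: "nat multiset \<Rightarrow> game" where
  "nim M = (\<Sum>h\<in>#M. nimber h)"

lemma nim_add_mset: "nim (add_mset h M) = nimber h + nim M"
  by (simp add: nim_def)

lemma move_plus: "move (G + H) x \<longleftrightarrow> (\<exists>g. move G g \<and> x = g + H) \<or> (\<exists>h. move H h \<and> x = G + h)"
  unfolding move_def options_plus' by auto

lemma move_nimI: "k < h \<Longrightarrow> move (nim (add_mset h R)) (nim (add_mset k R))"
  unfolding nim_add_mset move_plus move_nimber by blast

lemma move_nim: "move (nim M) x \<longleftrightarrow> (\<exists>h R k. M = add_mset h R \<and> k < h \<and> x = nim (add_mset k R))"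
proof
  show "move (nim M) x \<Longrightarrow> \<exists>h R k. M = add_mset h R \<and> k < h \<and> x = nim (add_mset k R)"
  proof (induction M arbitrary: x)
    case empty
    then show ?case by (simp add: nim_def move_def)
  next
    case (add g M)
    from add.prems consider k where "k < g" "x = nimber k + nim M"
      | y where "move (nim M) y" "x = nimber g + y"
      by (auto simp: nim_add_mset move_plus move_nimber)
    then show ?case
    proof cases
      case 1
      then show ?thesis by (metis nim_add_mset)
    next
      case 2
      from add.IH[OF 2(1)] obtain h R k where "M = add_mset h R" "k < h" "y = nim (add_mset k R)"
        by blast
      then have "add_mset g M = add_mset h (add_mset g R) \<and> k < h \<and> x = nim (add_mset k (add_mset g R))"
        using 2(2) by (simp add: nim_add_mset add.left_commute)
      then show ?thesis by blast
    qed
  qed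
next
  show "\<exists>h R k. M = add_mset h R \<and> k < h \<and> x = nim (add_mset k R) \<Longrightarrow> move (nim M) x"
    using move_nimI by blast
qed

lemma xor_cancel_right: "(a XOR c = b XOR c) \<longleftrightarrow> a = (b :: nat)"
  by (metis xor.assoc xor_self_eq xor.right_neutral)

theorem grundy_nim: "grundy (nim M) = nim_sum M"
proof (induction "sum_mset M" arbitrary: M rule: less_induct)
  case less
  have IH: "grundy (nim (add_mset k R)) = k XOR nim_sum R" if "M = add_mset h R" "k < h" for h k R
    using less[of "add_mset k R"] that by simp
  show ?case
  proof (rule grundy_eqI)
    fix g assume "move (nim M) g"
    then show "grundy g \<noteq> nim_sum M"
      using IH by (auto simp: move_nim xor_cancel_right)
  next
    fix w assume "w < nim_sum M"
    from less_nim_sum[OF this] show "\<exists>g. move (nim M) g \<and> grundy g = w"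
      using IH by (metis move_nimI)
  qed
qed

text \<open>Removing the tokens one at a time gives a play of this length.\<close>

lemma sum_mset_le_birthday: "sum_mset M \<le> birthday (nim M)"
proof (induction "sum_mset M" arbitrary: M)
  case 0
  then show ?case by (metis le0)
next
  case (Suc s)
  then obtain h where "h \<in># M" "h \<noteq> 0"
    by (metis nat.simps(3) sum_mset_0_iff)
  then obtain k R where M: "M = add_mset (Suc k) R"
    by (metis mset_add not0_implies_Suc)
  have "s \<le> birthday (nim (add_mset k R))"
    using Suc M by (metis Suc_inject add_Suc sum_mset.add_mset)
  moreover have "Suc (birthday (nim (add_mset k R))) \<le> birthday (nim M)"
    using move_nimI[of k "Suc k" R] M birthday_rec[of "nim M"]
    by (auto simp: move_def intro!: Max_ge)
  ultimately show ?case using Suc.hyps(2) by simp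
qed

section \<open>Split sums of Nim positions with nimbers\<close>

lemma nim_neq_0: "1 \<in># M \<Longrightarrow> nim M \<noteq> 0"
  using move_nimI[of 0 1 "M - {#1#}"] by (auto simp: move_def)

text \<open>
  For a Nim position that is not exhausted there is at most one such \<open>v\<close>. By the recursion for it,
  it is the least number that is not taken by an option; an exhausted option takes all numbers.
\<close>

definition balanced :: "nat multiset \<Rightarrow> nat \<Rightarrow> bool" where
  "balanced M v \<longleftrightarrow> P_position (nim M \<circ>\<^sub>s nimber v)"

lemma balanced_iff:
  assumes "1 \<in># M"
  shows "balanced M v \<longleftrightarrow>
    (\<forall>h R k. M = add_mset h R \<longrightarrow> k < h \<longrightarrow> \<not> balanced (add_mset k R) v) \<and> (\<forall>w<v. \<not> balanced M w)"
proof -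
  have "(\<forall>x. move (nim M) x \<longrightarrow> \<not> P_position (x \<circ>\<^sub>s nimber v)) \<longleftrightarrow>
      (\<forall>h R k. M = add_mset h R \<longrightarrow> k < h \<longrightarrow> \<not> balanced (add_mset k R) v)"
    by (auto simp: move_nim balanced_def)
  moreover have "(\<forall>b. move (nimber v) b \<longrightarrow> \<not> P_position (nim M \<circ>\<^sub>s b)) \<longleftrightarrow>
      (\<forall>w<v. \<not> balanced M w)"
    by (auto simp: move_nimber balanced_def)
  ultimately show ?thesis
    using P_position_split_sum[OF nim_neq_0[OF assms], of "nimber v"] by (simp add: balanced_def)
qed

lemma balanced_unique: "1 \<in># M \<Longrightarrow> balanced M v \<Longrightarrow> balanced M w \<Longrightarrow> v = w"
  using P_position_split_nimber_unique nim_neq_0 unfolding balanced_def by blast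

lemma balanced_move:
  assumes "balanced (add_mset h R) v" "1 \<in># R" "k < h"
  shows "\<not> balanced (add_mset k R) v"
  using balanced_iff[of "add_mset h R" v] assms by simp

text \<open>
  The smaller of two neighbouring heap sizes is reachable from the larger one, so the two
  positions have different values and fill the pair of numbers whose half is \<open>j\<close>.
\<close>

lemma balanced_move_pair:
  assumes "1 \<in># R" "v div 2 = j" "balanced (add_mset (2 * i) R) v"
    "w div 2 = j" "balanced (add_mset (2 * i + 1) R) w" "u div 2 = j"
  shows "u = v \<or> u = w"
proof -
  have "v \<noteq> w"
    using balanced_move[of "2 * i + 1" R w "2 * i"] assms by auto
  then show ?thesis
    using same_half assms(2,4,6) by blast
qed

text \<open>
  A position with value \<open>2 * m\<close> and one with value \<open>2 * m + 1\<close> exclude both numbers as the value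
  of a common option.
\<close>

lemma balanced_common_option:
  assumes "1 \<in># S" "odd h" "odd h'"
    and "balanced (add_mset h' (add_mset (h - 1) S)) (2 * m)"
    and "balanced (add_mset h (add_mset (h' - 1) S)) (2 * m + 1)"
    and "balanced (add_mset (h - 1) (add_mset (h' - 1) S)) v"
  shows "v div 2 \<noteq> m"
proof
  assume "v div 2 = m"
  then consider "v = 2 * m" | "v = 2 * m + 1" by linarith
  then show False
  proof cases
    case 1
    have "balanced (add_mset (h' - 1) (add_mset (h - 1) S)) v"
      using assms(6) by (simp add: add_mset_commute)
    then show False
      using balanced_move[OF assms(4), of "h' - 1"] assms(1) odd_pos[OF assms(3)] 1 by simp
  next
    case 2
    then show False
      using balanced_move[OF assms(5), of "h - 1"] assms(1,6) odd_pos[OF assms(2)] by simp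
  qed
qed

section \<open>Nim positions with many heaps of size one\<close>

text \<open>
  The bound on the number of stars must survive the induction. A move in a larger heap lowers
  the right-hand side by at least one, which makes room for the removal of one star
  (\<open>many_ones_two_moves\<close>); removing a star alone may violate the bound. The constant \<open>2\<close> ensures
  that neither the position nor any of its options is exhausted.
\<close>

definition many_ones :: "nat multiset \<Rightarrow> bool" where
  "many_ones M \<longleftrightarrow> count M 1 \<ge> 2 + (\<Sum>h\<in>#M. if h = 1 then 0 else h)"

lemma many_ones_move:
  assumes "many_ones (add_mset h R)" "k < h" "h \<noteq> 1"
  shows "many_ones (add_mset k R)"
  using assms by (auto simp: many_ones_def)

lemma many_ones_move_one:
  assumes "many_ones (add_mset h (add_mset 1 R))" "k < h" "h \<noteq> 1"
  shows "many_ones (add_mset k (add_mset 0 R))"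
  using assms by (auto simp: many_ones_def)

lemma many_ones_two_moves:
  assumes ones: "many_ones (add_mset h (add_mset h' R))" and "k < h" "k' < h'" "h \<noteq> h'"
  shows "many_ones (add_mset k (add_mset k' R))"
proof -
  consider "h = 1" "h' \<noteq> 1" | "h \<noteq> 1" "h' = 1" | "h \<noteq> 1" "h' \<noteq> 1"
    using \<open>h \<noteq> h'\<close> by blast
  then show ?thesis
  proof cases
    case 1
    then show ?thesis
      using many_ones_move_one[of h' R k'] assms by (simp add: add_mset_commute)
  next
    case 2
    then show ?thesis
      using many_ones_move_one[of h R k] assms by simp
  next
    case 3
    have "many_ones (add_mset h' (add_mset k R))"
      using many_ones_move[OF ones \<open>k < h\<close> 3(1)] by (simp add: add_mset_commute)
    from many_ones_move[OF this \<open>k' < h'\<close> 3(2)] show ?thesis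
      by (simp add: add_mset_commute)
  qed
qed

lemma many_ones_remove:
  assumes "many_ones (add_mset h R)"
  shows "1 \<in># R"
proof -
  have "2 \<le> count (add_mset h R) 1"
    using assms unfolding many_ones_def by linarith
  then show ?thesis
    by (auto simp flip: count_greater_zero_iff split: if_splits)
qed

text \<open>
  The value of the position obtained by removing a star is unknown, since the induction
  hypothesis need not apply to it. This does no harm: values below the pair of the nim sum are
  reached by moves in larger heaps, and a clash within the pair is refuted by a common option of
  the two clashing options, at least one of which is a move in a larger heap.
\<close>

theorem many_ones_balanced:
  assumes "many_ones M"
  shows "\<exists>v. v div 2 = nim_sum M div 2 \<and> balanced M v"
  using assms
proof (induction "sum_mset M" arbitrary: M rule: less_induct)
  case less
  define m where "m = nim_sum M div 2"
  have one: "1 \<in># M"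
    using less.prems by (auto simp: many_ones_def simp flip: count_greater_zero_iff)
  have IH: "\<exists>v. v div 2 = nim_sum (add_mset k R) div 2 \<and> balanced (add_mset k R) v"
    if "M = add_mset h R" "k < h" "h \<noteq> 1" for h R k
    using less.hyps[of "add_mset k R"] many_ones_move[of h R k] less.prems that by simp
  have low: "\<not> balanced M w" if "w < 2 * m" for w
  proof -
    have "w div 2 < nim_sum (image_mset (\<lambda>h. h div 2) M)"
      using that by (simp add: m_def flip: nim_sum_div_2)
    \<comment> \<open>A Nim move in the halved heaps stands for two moves in the original heap, to \<open>2 * i\<close> and
      \<open>2 * i + 1\<close>.\<close>
    from less_nim_sum[OF this] obtain g S i where
      gS: "image_mset (\<lambda>h. h div 2) M = add_mset g S" and i: "i < g" "i XOR nim_sum S = w div 2"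
      by blast
    from gS obtain h R where M: "M = add_mset h R" and g: "g = h div 2"
      and S: "S = image_mset (\<lambda>h. h div 2) R"
      by (metis msed_map_invR)
    have pair: "\<exists>v. v div 2 = w div 2 \<and> balanced (add_mset k R) v" if "k div 2 = i" for k
    proof -
      have "k < h" "h \<noteq> 1"
        using i(1) g that by auto
      moreover have "nim_sum (add_mset k R) div 2 = w div 2"
        using that i(2) S by (simp add: xor_div_2 nim_sum_div_2)
      ultimately show ?thesis
        using IH[OF M] by metis
    qed
    obtain v1 v2 where v1: "v1 div 2 = w div 2" "balanced (add_mset (2 * i) R) v1"
      and v2: "v2 div 2 = w div 2" "balanced (add_mset (2 * i + 1) R) v2"
      using pair[of "2 * i"] pair[of "2 * i + 1"] by auto
    have "w = v1 \<or> w = v2"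
      using balanced_move_pair[OF many_ones_remove v1 v2 refl] less.prems M by simp
    then have "\<exists>k<h. balanced (add_mset k R) w"
    proof
      assume "w = v1"
      with v1(2) i(1) g show ?thesis by (intro exI[of _ "2 * i"]) auto
    next
      assume "w = v2"
      with v2(2) i(1) g show ?thesis by (intro exI[of _ "2 * i + 1"]) auto
    qed
    then show ?thesis
      using balanced_move many_ones_remove less.prems M by blast
  qed
  \<comment> \<open>An option with a value in the pair of \<open>M\<close> has the same nim sum up to the last digit, so only
    the last digit of one heap has changed.\<close>
  have opt: "\<exists>h R. M = add_mset h R \<and> odd h \<and> balanced (add_mset (h - 1) R) v"
    if v: "v div 2 = m" "\<not> balanced M v" "\<forall>w<v. \<not> balanced M w" for v
  proof -
    obtain h R k where M: "M = add_mset h R" and k: "k < h" and kv: "balanced (add_mset k R) v"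
      using balanced_iff[OF one, of v] v by blast
    have "k div 2 = h div 2"
    proof (cases "h = 1")
      case True
      then show ?thesis using k by simp
    next
      case False
      obtain u where u: "u div 2 = nim_sum (add_mset k R) div 2" "balanced (add_mset k R) u"
        using IH[OF M k False] by blast
      have "u = v"
        using balanced_unique[OF _ u(2) kv] many_ones_remove less.prems M by simp
      then have "nim_sum (add_mset k R) div 2 = nim_sum (add_mset h R) div 2"
        using u(1) v(1) m_def M by simp
      then show ?thesis
        by (simp add: xor_div_2 xor_cancel_right)
    qed
    then have "k = h - 1" "odd h"
      using k by presburger+
    then show ?thesis using M kv by blast
  qed
  have "balanced M (2 * m) \<or> balanced M (2 * m + 1)"
  proof (rule ccontr)
    assume none: "\<not> (balanced M (2 * m) \<or> balanced M (2 * m + 1))"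
    then have low': "\<forall>w<2 * m + 1. \<not> balanced M w"
      using low by (metis Suc_eq_plus1 less_Suc_eq)
    obtain h R where 1: "M = add_mset h R" "odd h" "balanced (add_mset (h - 1) R) (2 * m)"
      using opt[of "2 * m"] none low by auto
    obtain h' R' where 2: "M = add_mset h' R'" "odd h'" "balanced (add_mset (h' - 1) R') (2 * m + 1)"
      using opt[of "2 * m + 1"] none low' by auto
    have R: "1 \<in># R"
      using many_ones_remove less.prems 1(1) by simp
    \<comment> \<open>Equal heaps would yield one option with two values.\<close>
    have "h \<noteq> h'"
    proof
      assume "h = h'"
      then have "balanced (add_mset (h - 1) R) (2 * m + 1)"
        using 1(1) 2(1,3) by simp
      then show False
        using balanced_unique[OF _ 1(3), of "2 * m + 1"] R by simp
    qed
    then obtain S where S: "R = add_mset h' S" "R' = add_mset h S"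
      using 1(1) 2(1) by (metis add_eq_conv_ex)
    define Z where "Z = add_mset (h - 1) (add_mset (h' - 1) S)"
    have M: "M = add_mset h (add_mset h' S)" using 1(1) S by simp
    have pos: "h - 1 < h" "h' - 1 < h'"
      using odd_pos[OF 1(2)] odd_pos[OF 2(2)] by simp_all
    have "many_ones Z"
      unfolding Z_def using many_ones_two_moves less.prems pos \<open>h \<noteq> h'\<close> M by blast
    have "sum_mset Z < sum_mset M"
      using pos unfolding Z_def M by simp
    then obtain v where v: "v div 2 = nim_sum Z div 2" "balanced Z v"
      using less.hyps \<open>many_ones Z\<close> by blast
    have "(h - 1) div 2 = h div 2" "(h' - 1) div 2 = h' div 2"
      using 1(2) 2(2) by presburger+
    then have "nim_sum Z div 2 = m"
      unfolding m_def Z_def M by (simp add: xor_div_2)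
    have "1 \<in># add_mset (h' - 1) S"
      using many_ones_remove \<open>many_ones Z\<close> unfolding Z_def by blast
    moreover have "h' - 1 \<noteq> 1"
      using 2(2) by presburger
    ultimately have "1 \<in># S" by simp
    from balanced_common_option[OF this 1(2) 2(2), of m v] show False
      using 1(3) 2(3) v \<open>nim_sum Z div 2 = m\<close> unfolding Z_def S by (simp add: add_mset_commute)
  qed
  moreover have "(2 * m) div 2 = m" "(2 * m + 1) div 2 = m"
    by simp_all
  ultimately show ?case
    unfolding m_def by blast
qed

section \<open>Adding stars to a Nim game\<close>

lemma nim_game_imp_nim: "nim_game G \<Longrightarrow> \<exists>M. G = nim M"
  unfolding nim_game_def nim_def by (metis mset_map sum_mset_sum_list)

lemma nim_plus_stars: "nim M + stars n = nim (M + replicate_mset n 1)"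
proof (induction n)
  case (Suc n)
  have "nim M + stars (Suc n) = nimber 1 + (nim M + stars n)"
    by (simp add: stars_def add.left_commute)
  then show ?case by (simp add: Suc nim_add_mset)
qed (simp add: stars_def)

lemma move_stars: "move (stars (Suc n)) x \<Longrightarrow> x = stars n"
proof (induction n arbitrary: x)
  case 0
  then show ?case by (auto simp: stars_def move_nimber)
next
  case (Suc n)
  have eq: "stars (Suc k) = nimber 1 + stars k" for k
    by (simp add: stars_def)
  from Suc.prems consider "x = stars (Suc n)" | y where "move (stars (Suc n)) y" "x = nimber 1 + y"
    unfolding eq[of "Suc n"] by (auto simp: move_plus move_nimber)
  then show ?case
  proof cases
    case 2
    then show ?thesis using Suc.IH[of y] eq[of n] by simp
  qed simp
qed

lemma many_ones_add_stars:
  assumes "2 + sum_mset M \<le> n"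
  shows "many_ones (M + replicate_mset n 1)"
proof -
  have "(\<Sum>h\<in>#M. if h = 1 then 0 else h) \<le> sum_mset M"
    using sum_mset_mono[of M "\<lambda>h. if h = 1 then 0 else h" "\<lambda>h. h"] by simp
  then show ?thesis
    using assms by (simp add: many_ones_def)
qed

lemma nim_sum_add_replicate_one_div_2: "nim_sum (M + replicate_mset n 1) div 2 = nim_sum M div 2"
  by (induction n) (simp_all add: xor_div_2)

lemma birthday_0_imp_0:
  assumes "birthday G = 0"
  shows "G = 0"
proof -
  have "\<not> move G g" for g
  proof
    assume "move G g"
    then have "Suc (birthday g) \<le> birthday G"
      by (subst birthday_rec) (auto simp: move_def intro!: Max_ge)
    then show False using assms by simp
  qed
  then have "options G = options 0" by (auto simp: move_def)
  then show ?thesis by (rule game.expand)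
qed

theorem theorem7:
  fixes G :: game and n :: nat
  assumes "nim_game G"
    and "n \<ge> 2 * birthday G + 1"
  shows "P_position ((G + stars n) \<circ>\<^sub>s G) \<or> P_position ((G + stars (n + 1)) \<circ>\<^sub>s G)"
proof (cases "birthday G = 0")
  \<comment> \<open>Here \<open>n\<close> may be \<open>1\<close>, too few stars for \<open>many_ones\<close>; but the split sum is just \<open>stars n\<close>, and
    \<open>stars n\<close> is the only option of \<open>stars (n + 1)\<close>.\<close>
  case True
  then have "G = 0" by (rule birthday_0_imp_0)
  moreover have "P_position (stars n) \<or> P_position (stars (n + 1))"
    using P_position_rec[of "stars (n + 1)"] move_stars by auto
  ultimately show ?thesis by simp
next
  case False
  obtain M where M: "G = nim M"
    using nim_game_imp_nim[OF assms(1)] by blast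
  define L where "L k = M + replicate_mset k 1" for k :: nat
  have L: "G + stars k = nim (L k)" for k
    by (simp add: M L_def nim_plus_stars)
  have "2 + sum_mset M \<le> n"
    using False assms(2) sum_mset_le_birthday[of M] M by simp
  then have ones: "many_ones (L n)" "many_ones (L (n + 1))"
    unfolding L_def using many_ones_add_stars[of M n] many_ones_add_stars[of M "n + 1"] by linarith+
  have div: "nim_sum (L k) div 2 = grundy G div 2" for k
    unfolding L_def M grundy_nim by (rule nim_sum_add_replicate_one_div_2)
  obtain v w where v: "v div 2 = grundy G div 2" "balanced (L n) v"
    and w: "w div 2 = grundy G div 2" "balanced (L (n + 1)) w"
    using ones[THEN many_ones_balanced] unfolding div by blast
  have "L (n + 1) = add_mset 1 (L n)" "1 \<in># L n"
    using \<open>2 + sum_mset M \<le> n\<close> by (simp_all add: L_def)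
  \<comment> \<open>Removing a star leaves an empty heap, which does not change the game.\<close>
  moreover have "balanced (add_mset 0 (L n)) v"
    using v(2) by (simp add: balanced_def nim_add_mset)
  ultimately have "v \<noteq> w"
    using balanced_move[of 1 "L n" w 0] w(2) by auto
  then have "grundy G = v \<or> grundy G = w"
    using same_half[OF v(1) w(1) refl] by blast
  then show ?thesis
    using v(2) w(2) P_position_split_sum_grundy unfolding L balanced_def by metis
qed

end
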